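(* Let $t$ be a positive integer with $t\equiv \mathfrak t\pmod{2730}$ for some $\mathfrak t\in\{1369,2599\}$. Then $659_2^{(2;t)}=659\cdot(2^{12t}-1)/(2^{12}-1)$ is a Riesel number.
   Context: For integers $b\ge2$, $k\ge1$, $t\ge1$ and $z\ge0$, the $b$-repstring is $k_b^{(z;t)}=k\,(b^{(z+\ell)t}-1)/(b^{z+\ell}-1)$ where $\ell=\lfloor\log_b k\rfloor+1$; for $k=659$, $b=2$ one has $\ell=10$. A Riesel number is an odd positive integer $k$ such that $k\cdot 2^n-1$ is composite for all positive integers $n$. *)

theory Defs
  imports Complex_Main "HOL-Number_Theory.Number_Theory"
begin

definition num_digits :: "nat \<Rightarrow> nat \<Rightarrow> nat" where
  "num_digits b k = nat \<lfloor>log (real b) (real k)\<rfloor> + 1"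

text \<open>Meant for \<open>b \<ge> 2\<close> and \<open>k \<ge> 1\<close>; the division is then exact
  (see \<open>real_repstring\<close>). It is the number whose base \<open>b\<close> representation consists of \<open>t\<close>
  copies of the base \<open>b\<close> digits of \<open>k\<close>, successive copies separated by \<open>z\<close> zeros.\<close>

definition repstring :: "nat \<Rightarrow> nat \<Rightarrow> nat \<Rightarrow> nat \<Rightarrow> nat" where
  "repstring b k z t =
     k * (b ^ ((z + num_digits b k) * t) - 1) div (b ^ (z + num_digits b k) - 1)"

lemma real_repstring:
  assumes "b \<ge> 2"
  shows "real (repstring b k z t) =
    real k * (real b ^ ((z + num_digits b k) * t) - 1) / (real b ^ (z + num_digits b k) - 1)"
proof -
  let ?m = "z + num_digits b k"
  have ge: "b ^ n \<ge> 1" for n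
    using assms by simp
  have "b ^ ?m - 1 dvd b ^ (?m * t) - 1"
  proof -
    have "int b ^ ?m - 1 dvd (int b ^ ?m) ^ t - 1"
      by (metis dvd_triv_left power_diff_1_eq)
    then have "int (b ^ ?m - 1) dvd int (b ^ (?m * t) - 1)"
      using ge by (simp add: of_nat_diff power_mult)
    then show ?thesis
      using int_dvd_int_iff by blast
  qed
  then have "b ^ ?m - 1 dvd k * (b ^ (?m * t) - 1)"
    by (rule dvd_mult)
  then have "real (repstring b k z t) = real (k * (b ^ (?m * t) - 1)) / real (b ^ ?m - 1)"
    unfolding repstring_def by (rule real_of_nat_div)
  then show ?thesis
    using ge by (simp add: of_nat_diff)
qed

definition composite :: "nat \<Rightarrow> bool" where
  "composite n \<longleftrightarrow> n > 1 \<and> \<not> prime n"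

definition riesel :: "nat \<Rightarrow> bool" where
  "riesel k \<longleftrightarrow> odd k \<and> (\<forall>n\<ge>1. composite (k * 2 ^ n - 1))"

end

theory Submission
  imports Defs
begin

text \<open>Write \<open>k = 659 * S\<close> with \<open>S = (\<Sum>i<t. 4096 ^ i)\<close>. Since \<open>2 ^ 12 \<equiv> 1\<close> modulo
  \<open>4095 = 3\<^sup>2 * 5 * 7 * 13\<close> and \<open>2 ^ 12 \<equiv> -1\<close> modulo \<open>4097 = 17 * 241\<close>, we have
  \<open>S \<equiv> t\<close> modulo 3, 5, 7, 13 and, as \<open>t\<close> is odd, \<open>S \<equiv> 1\<close> modulo 17 and 241. Thus \<open>k\<close> has
  a known residue modulo each of these primes, and they form a covering set for
  \<open>k * 2 ^ n - 1\<close>, where \<open>n\<close> matters only modulo 24: the prime 3 handles odd \<open>n\<close>, 5 handles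
  \<open>n \<equiv> 0\<close> (mod 4), 7 and 13 handle \<open>n \<equiv> 2, 10\<close> (mod 12) in an order depending on \<open>t\<close>, and
  241 and 17 handle \<open>n \<equiv> 6\<close> and \<open>n \<equiv> 18\<close> (mod 24).\<close>

lemma num_digits_eqI:
  assumes "b \<ge> 2" "b ^ m \<le> k" "k < b ^ (m + 1)"
  shows "num_digits b k = m + 1"
  using floor_log_nat_eq_if[of b m k] assms by (simp add: num_digits_def)

lemma repstring_eq_sum:
  assumes "b \<ge> 2" "z + num_digits b k > 0"
  shows "repstring b k z t = k * (\<Sum>i<t. (b ^ (z + num_digits b k)) ^ i)"
proof -
  define q where "q = b ^ (z + num_digits b k)"
  have q: "q > 1"
    unfolding q_def using assms by (intro one_less_power) auto
  have "int (q ^ t - 1) = int ((q - 1) * (\<Sum>i<t. q ^ i))"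
    using q power_diff_1_eq[of "int q" t] by (simp add: of_nat_diff)
  then have "q ^ t - 1 = (q - 1) * (\<Sum>i<t. q ^ i)"
    by (simp only: of_nat_eq_iff)
  then have "k * (q ^ t - 1) div (q - 1) = k * (\<Sum>i<t. q ^ i)"
    using q by (metis mult.left_commute nonzero_mult_div_cancel_left not_less_iff_gr_or_eq zero_less_diff)
  then show ?thesis
    by (simp add: repstring_def q_def power_mult)
qed

lemma cong_sum_powers_1:
  fixes q m :: nat
  assumes "[q = 1] (mod m)"
  shows "[(\<Sum>i<t. q ^ i) = t] (mod m)"
proof -
  have "[(\<Sum>i<t. q ^ i) = (\<Sum>i<t. 1)] (mod m)"
    using cong_pow[OF assms] by (intro cong_sum) auto
  then show ?thesis by simp
qed

text \<open>Here \<open>q\<close> is -1 modulo \<open>m\<close>, so consecutive powers cancel in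
  pairs and an odd number of them leaves 1; \<open>m dvd q + 1\<close> expresses this within the
  naturals.\<close>

lemma cong_sum_powers_odd:
  fixes q m :: nat
  assumes "m dvd q + 1" "odd t"
  shows "[(\<Sum>i<t. q ^ i) = 1] (mod m)"
proof -
  obtain s where t: "t = 2 * s + 1"
    using assms(2) by (rule oddE)
  have "[(\<Sum>i<2 * s + 1. q ^ i) = 1] (mod m)"
  proof (induction s)
    case 0
    then show ?case by simp
  next
    case (Suc s)
    \<comment> \<open>The two new terms are grouped as a multiple of \<open>q + 1\<close>.\<close>
    have "(\<Sum>i<2 * Suc s + 1. q ^ i) = (\<Sum>i<2 * s + 1. q ^ i) + (q + 1) * q ^ (2 * s + 1)"
      by (simp add: algebra_simps)
    moreover have "[(q + 1) * q ^ (2 * s + 1) = 0] (mod m)"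
      using assms(1) by (simp only: cong_0_iff dvd_mult2)
    ultimately show ?case
      using cong_add[OF Suc.IH, of "(q + 1) * q ^ (2 * s + 1)" 0] by (simp only: add_0_right)
  qed
  then show ?thesis
    using t by simp
qed

text \<open>Modulo \<open>p\<close> the power \<open>b ^ n\<close> depends only on
  \<open>n mod d\<close>, so one numerical check for the residue \<open>c\<close> and the exponent
  \<open>a\<close> settles a whole class of \<open>n\<close>.\<close>

lemma dvd_mult_power_diff_1:
  fixes p b :: nat
  assumes "[b ^ d = 1] (mod p)" "[c * b ^ a = 1] (mod p)"
    and "[k = c] (mod p)" "n mod d = a"
  shows "p dvd k * b ^ n - 1"
proof -
  have "b ^ n = (b ^ d) ^ (n div d) * b ^ a"
    using assms(4) by (metis mult_div_mod_eq power_add power_mult)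
  then have "[k * b ^ n = c * (1 ^ (n div d) * b ^ a)] (mod p)"
    using cong_mult[OF assms(3) cong_mult[OF cong_pow[OF assms(1)] cong_refl]] by (simp only:)
  then have "[k * b ^ n = 1] (mod p)"
    using assms(2) by (auto intro: cong_trans)
  then show ?thesis
    using cong_to_1_nat by blast
qed

lemma composite_if_dvd:
  assumes "p dvd m" "1 < p" "p < m"
  shows "composite m"
  using assms by (auto simp: composite_def prime_nat_iff)

text \<open>Since \<open>k > 1\<close> and \<open>n \<ge> 1\<close>,
  \<open>k * 2 ^ n - 1 \<ge> 2 * k - 1 > k \<ge> p\<close>, so the divisor from \<open>P\<close> is
  proper.\<close>

lemma riesel_if_covering:
  assumes "odd k"
    and bounds: "\<And>p. p \<in> P \<Longrightarrow> 1 < p \<and> p \<le> k"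
    and cover: "\<And>n. n \<ge> 1 \<Longrightarrow> \<exists>p\<in>P. p dvd k * 2 ^ n - 1"
  shows "riesel k"
  unfolding riesel_def
proof (intro conjI allI impI)
  fix n :: nat
  assume "n \<ge> 1"
  then obtain p where "p \<in> P" and dvd: "p dvd k * 2 ^ n - 1"
    using cover by blast
  then have p: "1 < p" "p \<le> k"
    using bounds by auto
  have "(2::nat) \<le> 2 ^ n"
    using power_increasing[OF \<open>n \<ge> 1\<close>, of "2::nat"] by simp
  then have "k * 2 \<le> k * 2 ^ n"
    by (rule mult_le_mono2)
  moreover have "k \<noteq> 1"
    using p by linarith
  ultimately have "p < k * 2 ^ n - 1"
    using p by linarith
  with dvd p(1) show "composite (k * 2 ^ n - 1)"
    by (intro composite_if_dvd)
qed (fact assms(1))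

theorem theorem4p4:
  fixes t r :: nat
  assumes "t > 0"
    and "r \<in> {1369, 2599}"
    and "[t = r] (mod 2730)"
  shows "real (repstring 2 659 2 t) = 659 * (2 ^ (12 * t) - 1) / (2 ^ 12 - 1) \<and>
    riesel (repstring 2 659 2 t)"
proof
  have digits: "num_digits 2 659 = 10"
    using num_digits_eqI[of 2 9 659] by simp
  then show "real (repstring 2 659 2 t) = 659 * (2 ^ (12 * t) - 1) / (2 ^ 12 - 1)"
    using real_repstring[of 2 659 2 t] by simp

  define S :: nat where "S = (\<Sum>i<t. 4096 ^ i)"
  have rep: "repstring 2 659 2 t = 659 * S"
    using repstring_eq_sum[of 2 2 659 t] digits by (simp add: S_def)
  have t_cong: "[t = r] (mod m)" if "m dvd 2730" for m
    using assms(3) that by (rule cong_dvd_modulus_nat)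
  have "[t = 1] (mod 2)"
    using t_cong[of 2] assms(2) by (auto simp: cong_def)
  then have "odd t"
    by (simp add: cong_def odd_iff_mod_2_eq_one)
  have S_r: "[659 * S = 659 * r] (mod m)" if "m dvd 4095" "m dvd 2730" for m
  proof -
    have "[4096 = 1] (mod m)"
      using that(1) by (simp add: cong_altdef_nat)
    then have "[S = t] (mod m)"
      unfolding S_def by (rule cong_sum_powers_1)
    with t_cong[OF that(2)] show ?thesis
      by (auto intro: cong_mult cong_trans)
  qed
  have S_1: "[659 * S = 659] (mod m)" if "m dvd 4097" for m
    using cong_scalar_left[OF cong_sum_powers_odd[of m 4096 t], of 659] that \<open>odd t\<close>
    by (simp add: S_def)

  show "riesel (repstring 2 659 2 t)"
    unfolding rep
  proof (rule riesel_if_covering[where P = "{3, 5, 7, 13, 17, 241}"])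
    \<comment> \<open>Only the term for \<open>i = 0\<close> is odd.\<close>
    have "[S = 1] (mod 2)"
    proof -
      have "S = 1 + (\<Sum>i\<in>{1..<t}. 4096 ^ i)"
        using assms(1) by (simp add: S_def lessThan_atLeast0 sum.atLeast_Suc_lessThan)
      moreover have "even (\<Sum>i\<in>{1..<t}. 4096 ^ i :: nat)"
        by (intro dvd_sum) auto
      ultimately show ?thesis
        by (auto simp: cong_def elim!: evenE)
    qed
    then have "odd S"
      by (simp add: cong_def odd_iff_mod_2_eq_one)
    then show "odd (659 * S)"
      by simp
    from \<open>odd S\<close> have "S > 0"
      by (rule odd_pos)
    then show "1 < p \<and> p \<le> 659 * S" if "p \<in> {3, 5, 7, 13, 17, 241}" for p
      using that by auto
  next
    fix n :: nat
    let ?x = "659 * S * 2 ^ n - 1"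
    \<comment> \<open>In each of the six facts \<open>d\<close> is the order of 2 modulo the prime,
      and \<open>S_r\<close> or \<open>S_1\<close> fixes \<open>c\<close> as \<open>659 * r\<close>
      or 659.\<close>
    have 3: "3 dvd ?x" if "n mod 2 = 1"
      using assms(2) that
      by (intro dvd_mult_power_diff_1[where d = 2, OF _ _ S_r]) (auto simp: cong_def)
    have 5: "5 dvd ?x" if "n mod 4 = 0"
      using assms(2) that
      by (intro dvd_mult_power_diff_1[where d = 4, OF _ _ S_r]) (auto simp: cong_def)
    \<comment> \<open>Modulo 7, \<open>659 * r\<close> is 4 for 1369 and 2 for 2599; modulo 13 it is
      10 and 4.\<close>
    have 7: "7 dvd ?x" if "n mod 3 = (if r = 1369 then 1 else 2)"
      using assms(2) that
      by (intro dvd_mult_power_diff_1[where d = 3, OF _ _ S_r]) (auto simp: cong_def)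
    have 13: "13 dvd ?x" if "n mod 12 = (if r = 1369 then 2 else 10)"
      using assms(2) that
      by (intro dvd_mult_power_diff_1[where d = 12, OF _ _ S_r]) (auto simp: cong_def)
    have 17: "17 dvd ?x" if "n mod 8 = 2"
      using that by (intro dvd_mult_power_diff_1[where d = 8, OF _ _ S_1]) (auto simp: cong_def)
    have 241: "241 dvd ?x" if "n mod 24 = 6"
      using that by (intro dvd_mult_power_diff_1[where d = 24, OF _ _ S_1]) (auto simp: cong_def)
    \<comment> \<open>24 is the least common multiple of the six orders, so a finite check
      suffices.\<close>
    have residues: "\<forall>m\<in>set [0..<24::nat]. m mod 2 = 1 \<or> m mod 4 = 0 \<or>
        m mod 12 = 2 \<and> m mod 3 = 2 \<or> m mod 12 = 10 \<and> m mod 3 = 1 \<or> m = 6 \<or> m mod 8 = 2"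
      by code_simp
    consider "n mod 2 = 1" | "n mod 4 = 0" | "n mod 12 = 2" "n mod 3 = 2"
      | "n mod 12 = 10" "n mod 3 = 1" | "n mod 24 = 6" | "n mod 8 = 2"
      using bspec[OF residues, of "n mod 24"] by (auto simp: mod_mod_cancel)
    then have "3 dvd ?x \<or> 5 dvd ?x \<or> 7 dvd ?x \<or> 13 dvd ?x \<or> 17 dvd ?x \<or> 241 dvd ?x"
    proof cases
      case 1
      then show ?thesis using 3 by iprover
    next
      case 2
      then show ?thesis using 5 by iprover
    next
      \<comment> \<open>The prime is 13 for \<open>r = 1369\<close> and 7 for
        \<open>r = 2599\<close>; in the next case they swap.\<close>
      case 3
      then show ?thesis using 7 13 by metis
    next
      case 4
      then show ?thesis using 7 13 by metis
    next
      case 5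
      then show ?thesis using 241 by iprover
    next
      case 6
      then show ?thesis using 17 by iprover
    qed
    then show "\<exists>p\<in>{3, 5, 7, 13, 17, 241}. p dvd ?x"
      by blast
  qed
qed

end
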